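(* Let $d,n\ge 1$ be integers. The number of points of the cube $C^d_n=\{1,\dots,n\}^d$ satisfies $$|C^d_n| = n^d=\sum_{s=0}^{d-1}\left\langle {d \atop s}\right\rangle T^d_{n-s},$$ where, for each $s\in\{0,\dots,d-1\}$ with $n-s\ge 1$, the Eulerian number $\left\langle {d \atop s}\right\rangle$ is the number of factorial $d$-dimensional tetrahedrons with edges of length $n-s$ contained in $C^d_n$. Moreover, for the sums of powers, $$\sum_{j=1}^{n} j^d=\sum_{s=0}^{d-1}\left\langle {d \atop s}\right\rangle T^{d+1}_{n-s},\qquad \sum_{m=1}^{n}\sum_{j=1}^{m} j^d=\sum_{s=0}^{d-1}\left\langle {d \atop s}\right\rangle T^{d+2}_{n-s},$$ and, for every integer $t\ge 1$, $$S^{(t)}_d(n)=\sum_{s=0}^{d-1}\left\langle {d \atop s}\right\rangle T^{d+t}_{n-s},$$ where $S^{(t)}_d(n)$ is the $t$-fold iterated sum of $d$-th powers.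
   Context: Eulerian numbers: for integers $d\ge 1$, $\left\langle {d \atop s}\right\rangle$ is defined by $\left\langle {1 \atop 0}\right\rangle=1$, $\left\langle {d \atop k}\right\rangle=0$ for $k\ge d$ or $k<0$, and $\left\langle {d \atop s}\right\rangle=(1+s)\left\langle {d-1 \atop s}\right\rangle+(d-s)\left\langle {d-1 \atop s-1}\right\rangle$ for $d\ge 2$, $0\le s\le d-1$. Tetrahedral numbers: for an integer $m$ and an integer $d\ge1$, $T^d_m=\dfrac{m(m+1)\cdots(m+d-1)}{d!}$ (this is $0$ for $-(d-1)\le m\le 0$). Iterated sums: $S^{(1)}_d(n)=\sum_{j=1}^n j^d$ and $S^{(t)}_d(n)=\sum_{m=1}^n S^{(t-1)}_d(m)$ for $t\ge 2$. Factorial tetrahedrons: for each permutation $(h_1,\dots,h_d)$ of $(1,\dots,d)$, form the chain of inequalities $n\ge X_{h_1}\,R_1\,X_{h_2}\,R_2\cdots R_{d-1}\,X_{h_d}\ge 1$, where $R_i$ is the sign $\ge$ if $h_{i+1}>h_i$ and the sign $>$ if $h_{i+1}<h_i$. The factorial tetrahedron in $C^d_n$ associated with this permutation is the set of $(X_1,\dots,X_d)\in\{1,\dots,n\}^d$ satisfying the chain. For $m\ge1$, it is said to have edges of length $m$ if it is a translate, by a vector of $\mathbb{Z}^d$, of the set $\{(X_1,\dots,X_d)\in\mathbb{Z}^d : m\ge X_{h_1}\ge X_{h_2}\ge\cdots\ge X_{h_d}\ge 1\}$. *)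

theory Defs
  imports Complex_Main "HOL-Library.FuncSet" "HOL-Combinatorics.Permutations"
begin

text \<open>The lower index ranges over the integers, with value 0 outside 0, ..., d - 1. Only
  \<open>d \<ge> 1\<close> is meaningful; the value at \<open>d = 0\<close> is a dummy.\<close>

fun eulerian :: "nat \<Rightarrow> int \<Rightarrow> int" where
  "eulerian 0 s = 0"
| "eulerian (Suc 0) s = (if s = 0 then 1 else 0)"
| "eulerian (Suc (Suc d)) s =
     (if 0 \<le> s \<and> s < int (Suc (Suc d))
      then (1 + s) * eulerian (Suc d) s + (int (Suc (Suc d)) - s) * eulerian (Suc d) (s - 1)
      else 0)"

definition tetrahedral :: "nat \<Rightarrow> int \<Rightarrow> rat" where
  "tetrahedral d m = pochhammer (of_int m) d / fact d"

text \<open>The recursion is started at \<open>t = 0\<close> with the powers themselves, so that the value at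
  \<open>t = 1\<close> is the ordinary sum of powers.\<close>

primrec iterated_sum :: "nat \<Rightarrow> nat \<Rightarrow> nat \<Rightarrow> nat" where
  "iterated_sum 0 d n = n ^ d"
| "iterated_sum (Suc t) d n = (\<Sum>m = 1..n. iterated_sum t d m)"

text \<open>Points of the d-dimensional integer lattice are extensional functions on \<open>{1..d}\<close>, i.e.
  functions with the fixed value \<open>undefined\<close> outside \<open>{1..d}\<close>, so that cardinalities of sets of
  points are the intended ones.\<close>

definition lattice_points :: "nat \<Rightarrow> (nat \<Rightarrow> int) set" where
  "lattice_points d = {1..d} \<rightarrow>\<^sub>E UNIV"

definition cube :: "nat \<Rightarrow> nat \<Rightarrow> (nat \<Rightarrow> int) set" where
  "cube d n = {1..d} \<rightarrow>\<^sub>E {1..int n}"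

definition translate :: "nat \<Rightarrow> (nat \<Rightarrow> int) \<Rightarrow> (nat \<Rightarrow> int) set \<Rightarrow> (nat \<Rightarrow> int) set" where
  "translate d v A = (\<lambda>X. \<lambda>i\<in>{1..d}. X i + v i) ` A"

text \<open>In the next two definitions \<open>h\<close> is meant to be a permutation of \<open>{1..d}\<close> and \<open>d \<ge> 1\<close>.\<close>

definition factorial_tetrahedron :: "nat \<Rightarrow> nat \<Rightarrow> (nat \<Rightarrow> nat) \<Rightarrow> (nat \<Rightarrow> int) set" where
  "factorial_tetrahedron d n h =
     {X \<in> cube d n.
        int n \<ge> X (h 1) \<and>
        (\<forall>i\<in>{1..<d}. (h (i + 1) > h i \<longrightarrow> X (h i) \<ge> X (h (i + 1))) \<and>
                      (h (i + 1) < h i \<longrightarrow> X (h i) > X (h (i + 1)))) \<and>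
        X (h d) \<ge> 1}"

definition standard_tetrahedron :: "nat \<Rightarrow> int \<Rightarrow> (nat \<Rightarrow> nat) \<Rightarrow> (nat \<Rightarrow> int) set" where
  "standard_tetrahedron d m h =
     {X \<in> lattice_points d.
        m \<ge> X (h 1) \<and> (\<forall>i\<in>{1..<d}. X (h i) \<ge> X (h (i + 1))) \<and> X (h d) \<ge> 1}"

definition has_edge_length :: "nat \<Rightarrow> (nat \<Rightarrow> nat) \<Rightarrow> (nat \<Rightarrow> int) set \<Rightarrow> int \<Rightarrow> bool" where
  "has_edge_length d h A m \<longleftrightarrow>
     m \<ge> 1 \<and> (\<exists>v\<in>lattice_points d. A = translate d v (standard_tetrahedron d m h))"

text \<open>The tetrahedra are counted as sets of points, not as permutations.\<close>

definition factorial_tetrahedra_of_edge_length ::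
  "nat \<Rightarrow> nat \<Rightarrow> int \<Rightarrow> (nat \<Rightarrow> int) set set" where
  "factorial_tetrahedra_of_edge_length d n m =
     {A. A \<subseteq> cube d n \<and>
         (\<exists>h. h permutes {1..d} \<and> A = factorial_tetrahedron d n h \<and> has_edge_length d h A m)}"

end

theory Submission
  imports Defs
begin

text \<open>Write \<open>T(d, m)\<close> for the tetrahedral numbers. The identities are algebra: since
  \<open>x T(d, x - s) = (s + 1) T(d + 1, x - s) + (d - s) T(d + 1, x - s - 1)\<close>
  (\<open>mult_tetrahedral\<close>), multiplying an expansion of \<open>x ^ d\<close> by \<open>x\<close> transforms its coefficients by
  the Eulerian recursion, which gives Worpitzky's identity (\<open>worpitzky\<close>). Summation over \<open>n\<close>
  raises the dimension of every tetrahedral number by one (\<open>sum_tetrahedral\<close>), which gives the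
  iterated sums.

  For the geometric claim, a point of the cube lies in the tetrahedron of \<open>h\<close> exactly when \<open>h\<close>
  lists the coordinates by decreasing value, equal values by increasing index. There is
  exactly one such list, so the tetrahedra partition the cube (\<open>ex1_factorial_tetrahedron\<close>).
  Every descent of \<open>h\<close> makes one inequality of the chain strict; moving the coordinates before it
  down by one makes it weak again, at the cost of one unit of edge length. So the tetrahedron of
  \<open>h\<close> is a translate of the standard one with edges of length \<open>n - k\<close>, where \<open>k\<close> is the number of
  descents of \<open>h\<close> (\<open>factorial_tetrahedron_eq_translate\<close>).

  That the Eulerian number counts the permutations with \<open>s\<close> descents is read off from the cube
  itself: counting its points tetrahedron by tetrahedron expands \<open>n ^ d\<close> in the numbers
  \<open>T(d, n - s)\<close> with the descent counts as coefficients, Worpitzky's identity expands it with the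
  Eulerian numbers, and such an expansion is unique (\<open>tetrahedral_coefficients_unique\<close>).\<close>

section \<open>Tetrahedral numbers and Worpitzky's identity\<close>

lemma tetrahedral_diff:
  "tetrahedral (Suc d) m - tetrahedral (Suc d) (m - 1) = tetrahedral d m"
proof -
  let ?p = "pochhammer (of_int m :: rat) d"
  have "pochhammer (of_int (m - 1)) (Suc d) = (of_int m - 1 :: rat) * ?p"
    by (simp add: pochhammer_rec)
  moreover have "pochhammer (of_int m) (Suc d) = (of_int m + of_nat d) * ?p"
    by (simp add: pochhammer_Suc mult.commute)
  ultimately have "tetrahedral (Suc d) m - tetrahedral (Suc d) (m - 1)
      = ((of_int m + of_nat d) - (of_int m - 1)) * ?p / fact (Suc d)"
    unfolding tetrahedral_def by (simp only: left_diff_distrib diff_divide_distrib)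
  also have "(of_int m + of_nat d) - (of_int m - 1) = (of_nat (Suc d) :: rat)"
    by simp
  also have "\<dots> * ?p / fact (Suc d) = tetrahedral d m"
    unfolding tetrahedral_def fact_Suc by (rule mult_divide_mult_cancel_left) (rule of_nat_neq_0)
  finally show ?thesis .
qed

lemma tetrahedral_eq_0:
  assumes "- int d < m" and "m \<le> 0"
  shows "tetrahedral d m = 0"
proof -
  have "(of_int m :: rat) = - of_nat (nat (- m))" and "nat (- m) < d"
    using assms by auto
  then have "pochhammer (of_int m :: rat) d = 0"
    unfolding pochhammer_eq_0_iff by blast
  then show ?thesis by (simp add: tetrahedral_def)
qed

lemma tetrahedral_1: "tetrahedral d 1 = 1"
  by (simp add: tetrahedral_def pochhammer_fact[symmetric])

text \<open>The difference equation telescopes; the lower boundary term \<open>T(d + 1, - s)\<close> vanishes because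
  \<open>s \<le> d\<close> puts \<open>- s\<close> among the zeros of the rising factorial.\<close>
lemma sum_tetrahedral:
  assumes "s \<le> d"
  shows "(\<Sum>m = 1..n. tetrahedral d (int m - int s)) = tetrahedral (Suc d) (int n - int s)"
proof (induction n)
  case 0
  show ?case using assms by (simp add: tetrahedral_eq_0)
next
  case (Suc n)
  have "int (Suc n) - int s - 1 = int n - int s" by simp
  with Suc tetrahedral_diff[of d "int (Suc n) - int s"] show ?case
    by (simp add: algebra_simps)
qed

lemma eulerian_eq_0: "s < 0 \<or> int d \<le> s \<Longrightarrow> eulerian d s = 0"
proof (cases "(d, s)" rule: eulerian.cases)
  case (3 d' s')
  assume "s < 0 \<or> int d \<le> s"
  with 3 have "\<not> (0 \<le> s' \<and> s' < int (Suc (Suc d')))" by auto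
  then have "eulerian (Suc (Suc d')) s' = 0" by (simp only: eulerian.simps if_False)
  with 3 show ?thesis by simp
qed auto

text \<open>Both tetrahedral numbers on the right are \<open>T(d, m)\<close>, \<open>m = x - s\<close>, times a linear factor
  over \<open>d + 1\<close>, so the identity reduces to \<open>(1 + s) (m + d) + (d - s) (m - 1) = (d + 1) x\<close>.\<close>
lemma mult_tetrahedral:
  "of_int x * tetrahedral d (x - s) =
     (1 + of_int s) * tetrahedral (Suc d) (x - s)
     + (of_nat d - of_int s) * tetrahedral (Suc d) (x - (s + 1))"
proof -
  let ?p = "pochhammer (of_int (x - s) :: rat) d"
  have "pochhammer (of_int (x - (s + 1))) (Suc d) = (of_int (x - s) - 1 :: rat) * ?p"
    by (simp add: pochhammer_rec algebra_simps)
  then have lo: "tetrahedral (Suc d) (x - (s + 1)) = (of_int (x - s) - 1) * ?p / fact (Suc d)"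
    by (simp only: tetrahedral_def)
  have "pochhammer (of_int (x - s)) (Suc d) = (of_int (x - s) + of_nat d) * ?p"
    by (simp add: pochhammer_Suc mult.commute)
  then have hi: "tetrahedral (Suc d) (x - s) = (of_int (x - s) + of_nat d) * ?p / fact (Suc d)"
    by (simp only: tetrahedral_def)
  have "of_int x * tetrahedral d (x - s) = (of_nat (Suc d) * of_int x) * ?p / fact (Suc d)"
    unfolding tetrahedral_def fact_Suc mult.assoc
    by (subst mult_divide_mult_cancel_left) (simp_all del: of_nat_Suc)
  also have "(of_nat (Suc d) * of_int x :: rat) =
      (1 + of_int s) * (of_int (x - s) + of_nat d) + (of_nat d - of_int s) * (of_int (x - s) - 1)"
    by (simp add: algebra_simps)
  also have "(a * b + a' * b') * p / q = a * (b * p / q) + a' * (b' * p / q)"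
    for a b a' b' p q :: rat
    by (simp add: algebra_simps add_divide_distrib)
  finally show ?thesis
    by (simp only: lo hi)
qed

text \<open>The sum over \<open>s < d\<close> can be extended to \<open>s = d\<close> in the first half and shifted by one in the
  second, as the Eulerian numbers vanish outside their range; then the two halves combine by the
  defining recursion.\<close>
lemma worpitzky:
  assumes "d \<ge> 1"
  shows "(of_int x :: rat) ^ d =
    (\<Sum>s < d. of_int (eulerian d (int s)) * tetrahedral d (x - int s))"
  using assms
proof (induction d rule: nat_induct_at_least)
  case base
  show ?case by (simp add: tetrahedral_def)
next
  case (Suc d)
  let ?T = "\<lambda>s. tetrahedral (Suc d) (x - int s)"
  let ?e = "\<lambda>s. of_int (eulerian d (int s)) :: rat"
  obtain c where c: "d = Suc c" using Suc.hyps by (cases d) auto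
  have rec: "of_int (eulerian (Suc d) (int s)) =
      (1 + of_nat s) * ?e s
      + (of_nat (Suc d) - of_nat s) * of_int (eulerian d (int s - 1))" if "s \<le> d" for s
    using that unfolding c by simp
  have "(of_int x :: rat) ^ Suc d =
      (\<Sum>s < d. ?e s * (of_int x * tetrahedral d (x - int s)))"
    by (simp add: Suc.IH sum_distrib_left algebra_simps)
  also have "\<dots> = (\<Sum>s < d. (1 + of_nat s) * ?e s * ?T s)
      + (\<Sum>s < d. (of_nat d - of_nat s) * ?e s * ?T (Suc s))"
    unfolding mult_tetrahedral by (simp add: sum.distrib[symmetric] algebra_simps)
  also have "(\<Sum>s < d. (1 + of_nat s) * ?e s * ?T s) =
      (\<Sum>s < Suc d. (1 + of_nat s) * ?e s * ?T s)"
    by (simp add: eulerian_eq_0)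
  also have "(\<Sum>s < d. (of_nat d - of_nat s) * ?e s * ?T (Suc s)) =
      (\<Sum>s < Suc d. (of_nat (Suc d) - of_nat s) * of_int (eulerian d (int s - 1)) * ?T s)"
    by (subst sum.lessThan_Suc_shift) (simp add: eulerian_eq_0)
  also have "(\<Sum>s < Suc d. (1 + of_nat s) * ?e s * ?T s) + \<dots> =
      (\<Sum>s < Suc d. of_int (eulerian (Suc d) (int s)) * ?T s)"
    unfolding sum.distrib[symmetric]
    by (intro sum.cong refl, subst rec) (simp_all add: distrib_right)
  finally show ?case .
qed

lemma iterated_sum_eq:
  assumes "d \<ge> 1"
  shows "(of_nat (iterated_sum t d n) :: rat) =
    (\<Sum>s < d. of_int (eulerian d (int s)) * tetrahedral (d + t) (int n - int s))"
proof (induction t arbitrary: n)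
  case 0
  show ?case using worpitzky[OF assms, of "int n"] by simp
next
  case (Suc t)
  have "(of_nat (iterated_sum (Suc t) d n) :: rat) =
      (\<Sum>s < d. \<Sum>m = 1..n. of_int (eulerian d (int s)) * tetrahedral (d + t) (int m - int s))"
    by (simp add: Suc.IH sum.swap[of _ "{..<d}"])
  also have "\<dots> = (\<Sum>s < d. of_int (eulerian d (int s)) * tetrahedral (d + Suc t) (int n - int s))"
    by (intro sum.cong refl) (simp add: sum_distrib_left[symmetric] sum_tetrahedral del: One_nat_def)
  finally show ?case .
qed

text \<open>The system is triangular: at \<open>n = s + 1\<close> the terms beyond \<open>s\<close> vanish and the term at \<open>s\<close> has
  the factor \<open>T(d, 1) = 1\<close>.\<close>
lemma tetrahedral_coefficients_unique:
  fixes f g :: "nat \<Rightarrow> rat"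
  assumes eq: "\<And>n. n \<ge> 1 \<Longrightarrow>
      (\<Sum>s < d. f s * tetrahedral d (int n - int s)) = (\<Sum>s < d. g s * tetrahedral d (int n - int s))"
    and "s < d"
  shows "f s = g s"
  using \<open>s < d\<close>
proof (induction s rule: less_induct)
  case (less s)
  have trunc: "(\<Sum>r < d. a r * tetrahedral d (int (Suc s) - int r)) =
      a s + (\<Sum>r < s. a r * tetrahedral d (int (Suc s) - int r))" for a :: "nat \<Rightarrow> rat"
  proof -
    have "(\<Sum>r < d. a r * tetrahedral d (int (Suc s) - int r)) =
        (\<Sum>r < Suc s. a r * tetrahedral d (int (Suc s) - int r))"
      using less.prems by (intro sum.mono_neutral_right) (auto simp: tetrahedral_eq_0)
    then show ?thesis by (simp add: tetrahedral_1)
  qed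
  have "(\<Sum>r < s. f r * tetrahedral d (int (Suc s) - int r)) =
      (\<Sum>r < s. g r * tetrahedral d (int (Suc s) - int r))"
    using less by (intro sum.cong) auto
  with eq[of "Suc s"] show ?case by (simp only: trunc) simp
qed

section \<open>Counting weakly decreasing sequences\<close>

definition chains :: "nat \<Rightarrow> int \<Rightarrow> int list set" where
  "chains d m = {xs. length xs = d \<and> sorted_wrt (\<ge>) xs \<and> set xs \<subseteq> {1..m}}"

lemma chains_Suc: "chains (Suc d) m = (\<Union>x\<in>{1..m}. Cons x ` chains d x)"
proof (intro set_eqI iffI)
  fix xs assume "xs \<in> chains (Suc d) m"
  then obtain y ys where "xs = y # ys" "y \<in> {1..m}" "ys \<in> chains d y"
    by (cases xs) (auto simp: chains_def subset_iff)
  then show "xs \<in> (\<Union>x\<in>{1..m}. Cons x ` chains d x)" by blast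
next
  fix xs assume "xs \<in> (\<Union>x\<in>{1..m}. Cons x ` chains d x)"
  then show "xs \<in> chains (Suc d) m" by (force simp: chains_def)
qed

lemma finite_chains: "finite (chains d m)"
proof (rule finite_subset)
  show "chains d m \<subseteq> {xs. set xs \<subseteq> {1..m} \<and> length xs = d}" by (auto simp: chains_def)
  show "finite {xs. set xs \<subseteq> {1..m} \<and> length xs = d}" by (rule finite_lists_length_eq) simp
qed

text \<open>Slicing by the first entry \<open>x\<close> leaves a chain of one entry less bounded by \<open>x\<close>, so the counts
  satisfy the same summation rule as the tetrahedral numbers.\<close>
lemma card_chains: "(of_nat (card (chains d (int m))) :: rat) = tetrahedral d (int m)"
proof (induction d arbitrary: m)
  case 0
  have "chains 0 (int m) = {[]}" by (auto simp: chains_def)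
  then show ?case by (simp add: tetrahedral_def)
next
  case (Suc d)
  have "card (chains (Suc d) (int m)) = (\<Sum>x\<in>{1..int m}. card (Cons x ` chains d x))"
    unfolding chains_Suc by (rule card_UN_disjoint) (auto simp: finite_chains)
  also have "\<dots> = (\<Sum>x\<in>int ` {1..m}. card (chains d x))"
    by (simp add: card_image image_int_atLeastAtMost)
  also have "\<dots> = (\<Sum>x = 1..m. card (chains d (int x)))"
    by (subst sum.reindex) auto
  finally show ?case
    using sum_tetrahedral[of 0 d m] by (simp add: Suc.IH del: One_nat_def)
qed

text \<open>For \<open>- d < m < 0\<close> there are no chains, in accordance with the zeros of the tetrahedral
  numbers; this covers the permutations with more than \<open>n\<close> descents.\<close>
lemma card_chains_int:
  assumes "- int d < m"
  shows "(of_nat (card (chains d m)) :: rat) = tetrahedral d m"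
proof (cases "m \<ge> 0")
  case True
  then show ?thesis using card_chains[of d "nat m"] by simp
next
  case False
  with assms have "chains d m = {}" by (auto simp: chains_def)
  with False assms show ?thesis by (simp add: tetrahedral_eq_0)
qed


section \<open>Sorting permutations\<close>

lemma sorted_wrt_map_upt:
  assumes "transp P"
  shows "sorted_wrt P (map f [1..<Suc d]) \<longleftrightarrow> (\<forall>i\<in>{1..<d}. P (f i) (f (i + 1)))"
proof -
  have "sorted_wrt P (map f [1..<Suc d]) \<longleftrightarrow> (\<forall>i. Suc i < d \<longrightarrow> P (f (Suc i)) (f (Suc (Suc i))))"
    by (auto simp: sorted_wrt_iff_nth_Suc_transp[OF assms] simp del: upt_Suc)
  also have "\<dots> \<longleftrightarrow> (\<forall>i\<in>{1..<d}. P (f i) (f (i + 1)))"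
    by (auto simp: Ball_def) (metis Suc_le_D)
  finally show ?thesis .
qed

lemma ex1_sorting_permutation:
  fixes g :: "nat \<Rightarrow> 'a::linorder"
  assumes inj: "inj_on g {1..d}"
  shows "\<exists>!h. h permutes {1..d} \<and> sorted_wrt (<) (map (g \<circ> h) [1..<Suc d])"
proof (rule ex_ex1I)
  define L where "L = sort_key g [1..<Suc d]"
  have L: "distinct L" "set L = {1..d}" "length L = d"
    by (simp_all add: L_def atLeastLessThanSuc_atLeastAtMost del: upt_Suc)
  have "distinct (map g L)" using inj L by (simp add: distinct_map)
  moreover have "sorted (map g L)" by (simp add: L_def)
  ultimately have sorted: "sorted_wrt (<) (map g L)" by (simp add: strict_sorted_iff)
  define h where "h i = (if i \<in> {1..d} then L ! (i - 1) else i)" for i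
  have map_h: "map h [1..<Suc d] = L"
    by (rule nth_equalityI) (simp_all add: L h_def del: upt_Suc)
  have "inj_on h {1..d}"
    using L by (auto simp: inj_on_def h_def nth_eq_iff_index_eq)
  moreover have "h ` {1..d} = {1..d}"
    using arg_cong[OF map_h, of set] L by (simp add: atLeastLessThanSuc_atLeastAtMost del: upt_Suc)
  ultimately have "h permutes {1..d}"
    by (intro bij_imp_permutes) (auto simp: bij_betw_def h_def)
  moreover have "map (g \<circ> h) [1..<Suc d] = map g L"
    unfolding map_h[symmetric] by simp
  ultimately show "\<exists>h. h permutes {1..d} \<and> sorted_wrt (<) (map (g \<circ> h) [1..<Suc d])"
    using sorted by auto
next
  fix h h' assume h: "h permutes {1..d} \<and> sorted_wrt (<) (map (g \<circ> h) [1..<Suc d])"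
    and h': "h' permutes {1..d} \<and> sorted_wrt (<) (map (g \<circ> h') [1..<Suc d])"
  have "set (map (g \<circ> p) [1..<Suc d]) = g ` {1..d}" if "p permutes {1..d}" for p
  proof -
    have "set (map (g \<circ> p) [1..<Suc d]) = g ` p ` {1..d}"
      by (simp add: image_image atLeastLessThanSuc_atLeastAtMost del: upt_Suc)
    then show ?thesis by (simp only: permutes_image[OF that])
  qed
  with h h' have "map (g \<circ> h) [1..<Suc d] = map (g \<circ> h') [1..<Suc d]"
    by (intro strict_sorted_equal) auto
  then have *: "g (h i) = g (h' i)" if "i \<in> {1..d}" for i
    using that by (auto simp: map_eq_conv simp del: upt_Suc)
  show "h = h'"
  proof
    fix i
    show "h i = h' i"
    proof (cases "i \<in> {1..d}")
      case True
      with h h' have "h i \<in> {1..d}" "h' i \<in> {1..d}" by (simp_all only: permutes_in_image)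
      with inj *[OF True] show ?thesis by (auto dest: inj_onD)
    next
      case False
      with h h' show ?thesis by (metis permutes_not_in)
    qed
  qed
qed

text \<open>The coordinates have to be sorted by decreasing value, ties by increasing index. The factor
  \<open>d + 1\<close> exceeds every difference of two indices, so that a single integer encodes this
  lexicographic order.\<close>
definition tie_break_key :: "nat \<Rightarrow> (nat \<Rightarrow> int) \<Rightarrow> nat \<Rightarrow> int" where
  "tie_break_key d X i = int i - (int d + 1) * X i"

lemma tie_break_key_less_iff:
  assumes "i \<in> {1..d}" "j \<in> {1..d}"
  shows "tie_break_key d X i < tie_break_key d X j \<longleftrightarrow> X j < X i \<or> (X i = X j \<and> i < j)"
proof -
  have key_less: "tie_break_key d X i < tie_break_key d X j"
    if "X j < X i" "i \<in> {1..d}" "j \<in> {1..d}" for i j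
  proof -
    have "(int d + 1) * (X j + 1) \<le> (int d + 1) * X i"
      using that by (intro mult_left_mono) auto
    with that show ?thesis by (auto simp: tie_break_key_def algebra_simps)
  qed
  show ?thesis
  proof (cases "X i" "X j" rule: linorder_cases)
    case less
    with assms show ?thesis using key_less[of i j] by auto
  next
    case equal
    then show ?thesis by (simp add: tie_break_key_def)
  next
    case greater
    with assms show ?thesis using key_less[of j i] by auto
  qed
qed

lemma inj_on_tie_break_key: "inj_on (tie_break_key d X) {1..d}"
proof (rule inj_onI)
  fix i j assume "i \<in> {1..d}" "j \<in> {1..d}" "tie_break_key d X i = tie_break_key d X j"
  then show "i = j"
    using tie_break_key_less_iff[of i d j X] tie_break_key_less_iff[of j d i X]
    by (cases i j rule: linorder_cases) auto
qed

section \<open>The factorial tetrahedra partition the cube\<close>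

lemma chain_decreasing:
  fixes f :: "nat \<Rightarrow> 'a::order"
  assumes "\<forall>i\<in>{1..<d}. f (i + 1) \<le> f i" and "i \<le> j" "1 \<le> i" "j \<le> d"
  shows "f j \<le> f i"
  using \<open>i \<le> j\<close> \<open>j \<le> d\<close>
proof (induction j rule: dec_induct)
  case base
  show ?case by simp
next
  case (step j)
  with assms(1,3) have "f (j + 1) \<le> f j" by auto
  with step show ?case by (auto intro: order_trans)
qed

text \<open>The chain bounds all coordinates, so membership in the cube can be weakened to membership in the
  lattice, and each of its inequalities is a weak one with a gap of one at a descent. In this form
  the effect of a translation is visible.\<close>
lemma factorial_tetrahedron_alt:
  assumes h: "h permutes {1..d}" and d: "d \<ge> 1"
  shows "factorial_tetrahedron d n h = {X \<in> lattice_points d. X (h 1) \<le> int n \<and>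
     (\<forall>i\<in>{1..<d}. X (h (i + 1)) + of_bool (h (i + 1) < h i) \<le> X (h i)) \<and> 1 \<le> X (h d)}"
    (is "_ = ?R")
proof -
  have neq: "h (i + 1) \<noteq> h i" for i
    using permutes_inj[OF h] by (simp add: inj_eq)
  have "X \<in> cube d n" if X: "X \<in> ?R" for X
  proof -
    have dec: "\<forall>i\<in>{1..<d}. X (h (i + 1)) \<le> X (h i)"
    proof
      fix i assume "i \<in> {1..<d}"
      with X have "X (h (i + 1)) + of_bool (h (i + 1) < h i) \<le> X (h i)" by blast
      moreover have "(0 :: int) \<le> of_bool (h (i + 1) < h i)" by simp
      ultimately show "X (h (i + 1)) \<le> X (h i)" by linarith
    qed
    have "X i \<in> {1..int n}" if i: "i \<in> {1..d}" for i
    proof -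
      obtain j where j: "j \<in> {1..d}" "i = h j"
        using i permutes_image[OF h] by blast
      have "X (h d) \<le> X (h j)" "X (h j) \<le> X (h 1)"
        using j d chain_decreasing[of d "\<lambda>i. X (h i)"] dec by auto
      with X j show ?thesis by auto
    qed
    with X show ?thesis by (auto simp: cube_def lattice_points_def)
  qed
  moreover have "cube d n \<subseteq> lattice_points d"
    by (auto simp: cube_def lattice_points_def)
  moreover have "((h (i + 1) > h i \<longrightarrow> X (h i) \<ge> X (h (i + 1))) \<and>
      (h (i + 1) < h i \<longrightarrow> X (h i) > X (h (i + 1)))) \<longleftrightarrow>
      X (h (i + 1)) + of_bool (h (i + 1) < h i) \<le> X (h i)" for i and X :: "nat \<Rightarrow> int"
    using neq[of i] by (auto simp: of_bool_def)
  ultimately show ?thesis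
    unfolding factorial_tetrahedron_def by auto
qed

lemma factorial_tetrahedron_iff_sorted:
  assumes h: "h permutes {1..d}" and d: "d \<ge> 1" and X: "X \<in> cube d n"
  shows "X \<in> factorial_tetrahedron d n h \<longleftrightarrow>
    sorted_wrt (<) (map (tie_break_key d X \<circ> h) [1..<Suc d])"
proof -
  have in_range: "h i \<in> {1..d}" if "i \<in> {1..d}" for i
    using that by (simp only: permutes_in_image[OF h])
  have "X (h 1) \<le> int n" "1 \<le> X (h d)" and "X \<in> lattice_points d"
    using X d in_range[of 1] in_range[of d] by (auto simp: cube_def lattice_points_def)
  moreover have "X (h (i + 1)) + of_bool (h (i + 1) < h i) \<le> X (h i) \<longleftrightarrow>
      tie_break_key d X (h i) < tie_break_key d X (h (i + 1))" if "i \<in> {1..<d}" for i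
  proof -
    have "h (i + 1) \<noteq> h i"
      using permutes_inj[OF h] by (simp add: inj_eq)
    then show ?thesis
      using that in_range by (subst tie_break_key_less_iff) (auto simp: of_bool_def)
  qed
  ultimately show ?thesis
    unfolding factorial_tetrahedron_alt[OF h d] by (subst sorted_wrt_map_upt) auto
qed

lemma ex1_factorial_tetrahedron:
  assumes "d \<ge> 1" and "X \<in> cube d n"
  shows "\<exists>!h. h permutes {1..d} \<and> X \<in> factorial_tetrahedron d n h"
proof -
  have "h permutes {1..d} \<and> X \<in> factorial_tetrahedron d n h \<longleftrightarrow>
      h permutes {1..d} \<and> sorted_wrt (<) (map (tie_break_key d X \<circ> h) [1..<Suc d])" for h
    using assms by (auto simp: factorial_tetrahedron_iff_sorted simp del: upt_Suc)
  then show ?thesis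
    using ex1_sorting_permutation[OF inj_on_tie_break_key] by presburger
qed

section \<open>Factorial tetrahedra as translates of standard ones\<close>

lemma card_translate:
  assumes "A \<subseteq> lattice_points d"
  shows "card (translate d v A) = card A"
proof -
  have "inj_on (\<lambda>X. \<lambda>i\<in>{1..d}. X i + v i) A"
  proof (rule inj_onI)
    fix X Y assume XY: "X \<in> A" "Y \<in> A"
      and eq: "(\<lambda>i\<in>{1..d}. X i + v i) = (\<lambda>i\<in>{1..d}. Y i + v i)"
    have "X i = Y i" if "i \<in> {1..d}" for i
      using fun_cong[OF eq, of i] that by simp
    with XY assms show "X = Y"
      unfolding lattice_points_def
      by (intro PiE_ext[of X "{1..d}" "\<lambda>_. UNIV" Y]) auto
  qed
  then show ?thesis unfolding translate_def by (rule card_image)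
qed

lemma mem_translate_iff:
  assumes "X \<in> lattice_points d" and "A \<subseteq> lattice_points d"
  shows "X \<in> translate d v A \<longleftrightarrow> (\<lambda>i\<in>{1..d}. X i - v i) \<in> A"
proof
  assume "X \<in> translate d v A"
  then obtain Y where Y: "Y \<in> A" "X = (\<lambda>i\<in>{1..d}. Y i + v i)"
    by (auto simp: translate_def)
  have "(\<lambda>i\<in>{1..d}. X i - v i) = Y"
    using Y assms by (auto simp: lattice_points_def fun_eq_iff PiE_def extensional_def)
  with Y show "(\<lambda>i\<in>{1..d}. X i - v i) \<in> A" by simp
next
  assume *: "(\<lambda>i\<in>{1..d}. X i - v i) \<in> A"
  have "X = (\<lambda>i\<in>{1..d}. (\<lambda>i\<in>{1..d}. X i - v i) i + v i)"
    using assms(1) by (auto simp: lattice_points_def fun_eq_iff PiE_def extensional_def)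
  with * show "X \<in> translate d v A" unfolding translate_def by blast
qed

definition descents :: "nat \<Rightarrow> (nat \<Rightarrow> nat) \<Rightarrow> nat set" where
  "descents d h = {i \<in> {1..<d}. h (i + 1) < h i}"

lemma finite_descents [simp]: "finite (descents d h)"
  by (simp add: descents_def)

lemma card_descents_less:
  assumes "d \<ge> 1"
  shows "card (descents d h) < d"
proof -
  have "card (descents d h) \<le> card {1..<d}"
    by (rule card_mono) (auto simp: descents_def)
  with assms show ?thesis by simp
qed

text \<open>Coordinate \<open>i\<close> stands at position \<open>inv h i\<close> of the chain and is moved by the number of strict
  signs to the right of that position.\<close>
definition descent_shift :: "nat \<Rightarrow> (nat \<Rightarrow> nat) \<Rightarrow> nat \<Rightarrow> int" where
  "descent_shift d h = (\<lambda>i\<in>{1..d}. int (card {j \<in> descents d h. inv h i \<le> j}))"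

lemma descent_shift_image:
  assumes "h permutes {1..d}" and "i \<in> {1..d}"
  shows "descent_shift d h (h i) = int (card {j \<in> descents d h. i \<le> j})"
  using assms permutes_in_image[OF assms(1), of i]
  by (simp add: descent_shift_def permutes_inverses)

lemma standard_tetrahedron_subset: "standard_tetrahedron d m h \<subseteq> lattice_points d"
  by (auto simp: standard_tetrahedron_def)

lemma factorial_tetrahedron_eq_translate:
  assumes h: "h permutes {1..d}" and d: "d \<ge> 1"
  shows "factorial_tetrahedron d n h =
    translate d (descent_shift d h)
      (standard_tetrahedron d (int n - int (card (descents d h))) h)"
proof -
  let ?v = "descent_shift d h" and ?S = "standard_tetrahedron d (int n - int (card (descents d h))) h"
  have in_range: "h i \<in> {1..d}" if "i \<in> {1..d}" for i
    using that by (simp only: permutes_in_image[OF h])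
  have "{j \<in> descents d h. 1 \<le> j} = descents d h" and "{j \<in> descents d h. d \<le> j} = {}"
    by (auto simp: descents_def)
  then have ends: "?v (h 1) = int (card (descents d h))" "?v (h d) = 0"
    using d descent_shift_image[OF h] by auto
  have step: "?v (h i) = ?v (h (i + 1)) + of_bool (h (i + 1) < h i)" if i: "i \<in> {1..<d}" for i
  proof -
    have "{j \<in> descents d h. i \<le> j} = {j \<in> descents d h. i + 1 \<le> j}
        \<union> (if h (i + 1) < h i then {i} else {})"
      using i by (auto simp: descents_def Suc_le_eq order_le_less)
    then show ?thesis
      using i by (simp add: descent_shift_image[OF h])
  qed
  have iff: "X \<in> factorial_tetrahedron d n h \<longleftrightarrow> (\<lambda>i\<in>{1..d}. X i - ?v i) \<in> ?S"
    if X: "X \<in> lattice_points d" for X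
  proof -
    let ?Y = "\<lambda>i\<in>{1..d}. X i - ?v i"
    have Y: "?Y (h i) = X (h i) - ?v (h i)" if "i \<in> {1..d}" for i
      using in_range[OF that] by simp
    have "?Y (h 1) \<le> int n - int (card (descents d h)) \<longleftrightarrow> X (h 1) \<le> int n"
      and "1 \<le> ?Y (h d) \<longleftrightarrow> 1 \<le> X (h d)"
      using d Y[of 1] Y[of d] ends by auto
    moreover have "?Y (h (i + 1)) \<le> ?Y (h i) \<longleftrightarrow>
        X (h (i + 1)) + of_bool (h (i + 1) < h i) \<le> X (h i)" if "i \<in> {1..<d}" for i
      using that Y[of i] Y[of "i + 1"] step[of i] by auto
    moreover have "?Y \<in> lattice_points d"
      by (simp add: lattice_points_def)
    ultimately show ?thesis
      using X unfolding factorial_tetrahedron_alt[OF h d] standard_tetrahedron_def by blast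
  qed
  have "translate d ?v ?S \<subseteq> lattice_points d"
    by (auto simp: translate_def lattice_points_def)
  moreover have "factorial_tetrahedron d n h \<subseteq> lattice_points d"
    unfolding factorial_tetrahedron_alt[OF h d] by blast
  moreover have "X \<in> factorial_tetrahedron d n h \<longleftrightarrow> X \<in> translate d ?v ?S"
    if "X \<in> lattice_points d" for X
    by (simp only: iff[OF that] mem_translate_iff[OF that standard_tetrahedron_subset])
  ultimately show ?thesis by blast
qed

lemma bij_betw_standard_tetrahedron_chains:
  assumes h: "h permutes {1..d}" and d: "d \<ge> 1"
  shows "bij_betw (\<lambda>X. map (X \<circ> h) [1..<Suc d]) (standard_tetrahedron d m h) (chains d m)"
proof (rule bij_betwI[where g = "\<lambda>xs. \<lambda>i\<in>{1..d}. xs ! (inv h i - 1)"])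
  have in_range: "h i \<in> {1..d}" if "i \<in> {1..d}" for i
    using that by (simp only: permutes_in_image[OF h])
  have inv_in_range: "inv h i \<in> {1..d}" if "i \<in> {1..d}" for i
    using that by (simp only: permutes_in_image[OF permutes_inv[OF h]])
  have sorted: "sorted_wrt (\<ge>) (map f [1..<Suc d]) \<longleftrightarrow> (\<forall>i\<in>{1..<d}. f (i + 1) \<le> f i)"
    for f :: "nat \<Rightarrow> int"
    by (rule sorted_wrt_map_upt) (auto simp: transp_def)
  show "(\<lambda>X. map (X \<circ> h) [1..<Suc d]) \<in> standard_tetrahedron d m h \<rightarrow> chains d m"
  proof
    fix X assume X: "X \<in> standard_tetrahedron d m h"
    then have dec: "\<forall>i\<in>{1..<d}. (X \<circ> h) (i + 1) \<le> (X \<circ> h) i"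
      by (simp add: standard_tetrahedron_def)
    have "(X \<circ> h) j \<in> {1..m}" if "j \<in> {1..d}" for j
      using chain_decreasing[OF dec, of 1 j] chain_decreasing[OF dec, of j d] X that
      by (auto simp: standard_tetrahedron_def)
    with dec sorted[of "X \<circ> h"] show "map (X \<circ> h) [1..<Suc d] \<in> chains d m"
      by (auto simp: chains_def simp del: upt_Suc)
  qed
  show "(\<lambda>xs. \<lambda>i\<in>{1..d}. xs ! (inv h i - 1)) \<in> chains d m \<rightarrow> standard_tetrahedron d m h"
  proof
    fix xs assume xs: "xs \<in> chains d m"
    have "xs = map (\<lambda>i. xs ! (i - 1)) [1..<Suc d]"
      using xs by (intro nth_equalityI) (simp_all add: chains_def del: upt_Suc)
    then have "\<forall>i\<in>{1..<d}. xs ! (i + 1 - 1) \<le> xs ! (i - 1)"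
      using xs sorted[of "\<lambda>i. xs ! (i - 1)"] by (simp add: chains_def del: upt_Suc)
    moreover have "xs ! i \<in> {1..m}" if "i < d" for i
      using xs that unfolding chains_def by (auto dest: nth_mem)
    from this[of 0] this[of "d - 1"] d have "xs ! 0 \<le> m" "1 \<le> xs ! (d - 1)" by auto
    ultimately show "(\<lambda>i\<in>{1..d}. xs ! (inv h i - 1)) \<in> standard_tetrahedron d m h"
      using d in_range[of 1] in_range[of d] in_range
      by (auto simp: standard_tetrahedron_def lattice_points_def permutes_inverses[OF h])
  qed
  show "(\<lambda>i\<in>{1..d}. map (X \<circ> h) [1..<Suc d] ! (inv h i - 1)) = X"
    if "X \<in> standard_tetrahedron d m h" for X
  proof
    fix i
    show "(\<lambda>i\<in>{1..d}. map (X \<circ> h) [1..<Suc d] ! (inv h i - 1)) i = X i"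
    proof (cases "i \<in> {1..d}")
      case True
      with inv_in_range[OF True] show ?thesis
        by (auto simp: permutes_inverses[OF h] simp del: upt_Suc)
    next
      case False
      with that show ?thesis
        by (auto simp: standard_tetrahedron_def lattice_points_def PiE_def extensional_def)
    qed
  qed
  show "map ((\<lambda>i\<in>{1..d}. xs ! (inv h i - 1)) \<circ> h) [1..<Suc d] = xs" if "xs \<in> chains d m" for xs
  proof (rule nth_equalityI)
    fix i assume "i < length (map ((\<lambda>i\<in>{1..d}. xs ! (inv h i - 1)) \<circ> h) [1..<Suc d])"
    then have "Suc i \<in> {1..d}" by (simp del: upt_Suc)
    from in_range[OF this] this show
      "map ((\<lambda>i\<in>{1..d}. xs ! (inv h i - 1)) \<circ> h) [1..<Suc d] ! i = xs ! i"
      by (simp add: permutes_inverses[OF h] del: upt_Suc)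
  qed (use that in \<open>simp add: chains_def del: upt_Suc\<close>)
qed

section \<open>Eulerian numbers count permutations by descents\<close>

lemma card_factorial_tetrahedron:
  assumes h: "h permutes {1..d}" and d: "d \<ge> 1"
  shows "(of_nat (card (factorial_tetrahedron d n h)) :: rat) =
    tetrahedral d (int n - int (card (descents d h)))"
proof -
  let ?m = "int n - int (card (descents d h))"
  have "card (factorial_tetrahedron d n h) = card (chains d ?m)"
    unfolding factorial_tetrahedron_eq_translate[OF assms]
    using card_translate[OF standard_tetrahedron_subset]
      bij_betw_same_card[OF bij_betw_standard_tetrahedron_chains[OF assms]] by simp
  then show ?thesis
    using card_chains_int[of d ?m] card_descents_less[OF d, of h] by simp
qed

lemma card_cube: "card (cube d n) = n ^ d"
  by (simp add: cube_def card_PiE)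

lemma power_eq_sum_descents:
  assumes "d \<ge> 1"
  shows "(of_nat n :: rat) ^ d = (\<Sum>s < d.
    of_nat (card {h. h permutes {1..d} \<and> card (descents d h) = s}) * tetrahedral d (int n - int s))"
proof -
  let ?P = "{h. h permutes {1..d}}"
  have fin: "finite ?P" by (rule finite_permutations) simp
  have sub: "factorial_tetrahedron d n h \<subseteq> cube d n" for h
    by (auto simp: factorial_tetrahedron_def)
  have "cube d n = (\<Union>h\<in>?P. factorial_tetrahedron d n h)"
  proof
    show "cube d n \<subseteq> (\<Union>h\<in>?P. factorial_tetrahedron d n h)"
      using ex1_factorial_tetrahedron[OF assms] by (fast dest: ex1_implies_ex)
  qed (use sub in blast)
  moreover have "finite (factorial_tetrahedron d n h)" for h
    using sub by (rule finite_subset) (auto simp: cube_def intro: finite_PiE)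
  moreover have "factorial_tetrahedron d n h \<inter> factorial_tetrahedron d n h' = {}"
    if "h \<in> ?P" "h' \<in> ?P" "h \<noteq> h'" for h h'
  proof (rule equals0I)
    fix X assume X: "X \<in> factorial_tetrahedron d n h \<inter> factorial_tetrahedron d n h'"
    then have "X \<in> cube d n" using sub by blast
    from ex1_factorial_tetrahedron[OF assms this] X that show False by auto
  qed
  ultimately have "card (cube d n) = (\<Sum>h\<in>?P. card (factorial_tetrahedron d n h))"
    using fin by (simp add: card_UN_disjoint)
  then have "(of_nat n :: rat) ^ d = (\<Sum>h\<in>?P. of_nat (card (factorial_tetrahedron d n h)))"
    unfolding card_cube by (simp flip: of_nat_power)
  also have "\<dots> = (\<Sum>h\<in>?P. tetrahedral d (int n - int (card (descents d h))))"
    by (intro sum.cong refl) (simp only: mem_Collect_eq card_factorial_tetrahedron[OF _ assms])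
  also have "\<dots> = (\<Sum>s < d. \<Sum>h | h \<in> ?P \<and> card (descents d h) = s.
      tetrahedral d (int n - int (card (descents d h))))"
    using fin card_descents_less[OF assms] by (intro sum.group[symmetric]) auto
  also have "\<dots> = (\<Sum>s < d.
      of_nat (card {h. h permutes {1..d} \<and> card (descents d h) = s}) * tetrahedral d (int n - int s))"
    by (intro sum.cong refl) simp
  finally show ?thesis .
qed

text \<open>Both sides are the coefficient of \<open>T(d, n - s)\<close> in an expansion of \<open>n ^ d\<close>, and that
  coefficient is unique.\<close>
lemma eulerian_eq_card_descents:
  assumes "s < d"
  shows "eulerian d (int s) = int (card {h. h permutes {1..d} \<and> card (descents d h) = s})"
proof -
  have d: "d \<ge> 1" using assms by simp
  have "of_int (eulerian d (int s)) =
      (of_nat (card {h. h permutes {1..d} \<and> card (descents d h) = s}) :: rat)"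
  proof (rule tetrahedral_coefficients_unique[OF _ assms])
    fix n :: nat
    show "(\<Sum>s < d. of_int (eulerian d (int s)) * tetrahedral d (int n - int s)) = (\<Sum>s < d.
        of_nat (card {h. h permutes {1..d} \<and> card (descents d h) = s}) * tetrahedral d (int n - int s))"
      using worpitzky[OF d, of "int n"] power_eq_sum_descents[OF d, of n] by (simp only: of_int_of_nat_eq)
  qed
  also have "\<dots> = of_int (int (card {h. h permutes {1..d} \<and> card (descents d h) = s}))"
    by simp
  finally show ?thesis by (simp only: of_int_eq_iff)
qed

section \<open>Counting tetrahedra by edge length\<close>

text \<open>The extent in one coordinate direction is unchanged by translations up to a shift, so its size
  recovers the edge length.\<close>
lemma standard_tetrahedron_extent:
  assumes h: "h permutes {1..d}" and d: "d \<ge> 1"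
  shows "(\<lambda>X. X (h 1)) ` standard_tetrahedron d m h = {1..m}"
proof (intro subset_antisym subsetI)
  fix c assume "c \<in> (\<lambda>X. X (h 1)) ` standard_tetrahedron d m h"
  then obtain X where X: "X \<in> standard_tetrahedron d m h" "c = X (h 1)" by auto
  then have "X (h d) \<le> X (h 1)"
    using d chain_decreasing[of d "\<lambda>i. X (h i)" 1 d] by (simp add: standard_tetrahedron_def)
  with X show "c \<in> {1..m}" by (simp add: standard_tetrahedron_def)
next
  \<comment> \<open>The points on the main diagonal already realise every value.\<close>
  fix c assume "c \<in> {1..m}"
  moreover have "h i \<in> {1..d}" if "i \<in> {1..d}" for i
    using that by (simp only: permutes_in_image[OF h])
  ultimately have "(\<lambda>i\<in>{1..d}. c) \<in> standard_tetrahedron d m h" "c = (\<lambda>i\<in>{1..d}. c) (h 1)"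
    using d by (auto simp: standard_tetrahedron_def lattice_points_def)
  from this(2,1) show "c \<in> (\<lambda>X. X (h 1)) ` standard_tetrahedron d m h"
    by (rule image_eqI[where f = "\<lambda>X. X (h 1)"])
qed

lemma card_extent_translate:
  assumes h: "h permutes {1..d}" and d: "d \<ge> 1"
  shows "card ((\<lambda>X. X (h 1)) ` translate d v (standard_tetrahedron d m h)) = nat m"
proof -
  have "h 1 \<in> {1..d}" using d permutes_in_image[OF h, of 1] by simp
  then have "(\<lambda>X. X (h 1)) ` translate d v (standard_tetrahedron d m h) =
      (\<lambda>c. c + v (h 1)) ` (\<lambda>X. X (h 1)) ` standard_tetrahedron d m h"
    unfolding translate_def image_image by simp
  then show ?thesis
    unfolding standard_tetrahedron_extent[OF assms] by (simp add: card_image)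
qed

lemma has_edge_length_factorial_tetrahedron_iff:
  assumes h: "h permutes {1..d}" and d: "d \<ge> 1" and m: "m \<ge> 1"
  shows "has_edge_length d h (factorial_tetrahedron d n h) m \<longleftrightarrow>
    m = int n - int (card (descents d h))"
proof
  assume "has_edge_length d h (factorial_tetrahedron d n h) m"
  then obtain v where "factorial_tetrahedron d n h = translate d v (standard_tetrahedron d m h)"
    by (auto simp: has_edge_length_def)
  then have "nat m = nat (int n - int (card (descents d h)))"
    using card_extent_translate[OF h d] factorial_tetrahedron_eq_translate[OF h d] by metis
  with m show "m = int n - int (card (descents d h))" by linarith
next
  assume "m = int n - int (card (descents d h))"
  moreover have "descent_shift d h \<in> lattice_points d"
    by (auto simp: descent_shift_def lattice_points_def)
  ultimately show "has_edge_length d h (factorial_tetrahedron d n h) m"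
    using m factorial_tetrahedron_eq_translate[OF h d] by (auto simp: has_edge_length_def)
qed

text \<open>Distinct permutations give distinct point sets here: the tetrahedra in question are nonempty, and
  those of distinct permutations have no common point.\<close>
lemma card_factorial_tetrahedra_of_edge_length:
  assumes d: "d \<ge> 1" and "s < n"
  shows "card (factorial_tetrahedra_of_edge_length d n (int n - int s)) =
    card {h. h permutes {1..d} \<and> card (descents d h) = s}" (is "_ = card ?H")
proof -
  have m: "int n - int s \<ge> 1" using assms by simp
  have "factorial_tetrahedra_of_edge_length d n (int n - int s) = factorial_tetrahedron d n ` ?H"
    using has_edge_length_factorial_tetrahedron_iff[OF _ d m]
    unfolding factorial_tetrahedra_of_edge_length_def
    by (auto simp: factorial_tetrahedron_def)
  moreover have "inj_on (factorial_tetrahedron d n) ?H"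
  proof (rule inj_onI)
    fix h h' assume h: "h \<in> ?H" "h' \<in> ?H"
      and eq: "factorial_tetrahedron d n h = factorial_tetrahedron d n h'"
    have "card ((\<lambda>X. X (h 1)) ` factorial_tetrahedron d n h) = nat (int n - int s)"
      using h card_extent_translate[OF _ d] factorial_tetrahedron_eq_translate[OF _ d]
      by (metis (mono_tags, lifting) mem_Collect_eq)
    with m have "factorial_tetrahedron d n h \<noteq> {}" by auto
    then obtain X where X: "X \<in> factorial_tetrahedron d n h" by blast
    then have "X \<in> cube d n" by (simp add: factorial_tetrahedron_def)
    with X eq h ex1_factorial_tetrahedron[OF d this] show "h = h'" by auto
  qed
  ultimately show ?thesis by (simp add: card_image)
qed

theorem mainTheorem1:
  fixes d n :: nat
  assumes "d \<ge> 1" and "n \<ge> 1"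
  shows "card (cube d n) = n ^ d
    \<and> (of_nat (n ^ d) :: rat) =
        (\<Sum>s = 0..d - 1. of_int (eulerian d (int s)) * tetrahedral d (int n - int s))
    \<and> (\<forall>s\<in>{0..d - 1}. int n - int s \<ge> 1 \<longrightarrow>
        eulerian d (int s) = int (card (factorial_tetrahedra_of_edge_length d n (int n - int s))))
    \<and> (of_nat (\<Sum>j = 1..n. j ^ d) :: rat) =
        (\<Sum>s = 0..d - 1. of_int (eulerian d (int s)) * tetrahedral (d + 1) (int n - int s))
    \<and> (of_nat (\<Sum>m = 1..n. \<Sum>j = 1..m. j ^ d) :: rat) =
        (\<Sum>s = 0..d - 1. of_int (eulerian d (int s)) * tetrahedral (d + 2) (int n - int s))
    \<and> (\<forall>t\<ge>1. (of_nat (iterated_sum t d n) :: rat) =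
        (\<Sum>s = 0..d - 1. of_int (eulerian d (int s)) * tetrahedral (d + t) (int n - int s)))"
proof -
  have range: "{0..d - 1} = {..<d}" using assms by auto
  have sums: "(of_nat (iterated_sum t d n) :: rat) =
      (\<Sum>s = 0..d - 1. of_int (eulerian d (int s)) * tetrahedral (d + t) (int n - int s))" for t
    unfolding range using assms(1) by (rule iterated_sum_eq)
  have "eulerian d (int s) = int (card (factorial_tetrahedra_of_edge_length d n (int n - int s)))"
    if "s \<in> {0..d - 1}" "int n - int s \<ge> 1" for s
    using that assms
    by (simp add: card_factorial_tetrahedra_of_edge_length eulerian_eq_card_descents)
  moreover have "iterated_sum 0 d n = n ^ d" "iterated_sum 1 d n = (\<Sum>j = 1..n. j ^ d)"
    "iterated_sum 2 d n = (\<Sum>m = 1..n. \<Sum>j = 1..m. j ^ d)"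
    by (simp_all add: numeral_2_eq_2)
  note sums[of 0, unfolded this add_0_right] sums[of 1, unfolded this] sums[of 2, unfolded this]
  ultimately show ?thesis
    by (intro conjI ballI allI impI card_cube sums)
qed

end
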